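(* Let $G$ be a graph on $m$ vertices and let $r$ be a positive integer. (i) Let $\ell$ be a positive integer such that $G\xrightarrow{r}\{C_3,C_5,\dots,C_{2\ell+1}\}$. Then for every integer $s\ge \ell+2$ there exists a positive integer $n$ such that $G^{\square n}\xrightarrow{r}C_{2s+1}$. (ii) In particular, if $\chi(G)>2r$ and $s$ is an integer with $2s+1\ge m+4$, then there exists a positive integer $n$ such that $G^{\square n}\xrightarrow{r}C_{2s+1}$.
   Context: Graphs are finite and simple; $\chi(G)$ is the chromatic number and $C_m$ is the cycle on $m$ vertices. The Cartesian product $G\square H$ of graphs $G,H$ has vertex set $V(G)\times V(H)$, and $(x_1,x_2),(y_1,y_2)$ are adjacent iff either $x_1y_1\in E(G)$ and $x_2=y_2$, or $x_1=y_1$ and $x_2y_2\in E(H)$. The $n$-th Cartesian power is $G^{\square 1}=G$, $G^{\square n}=G^{\square (n-1)}\square G$ for $n\ge 2$. For a positive integer $r$ and graphs $G, H_1,\dots,H_p$, $G\xrightarrow{r}\{H_1,\dots,H_p\}$ means that every coloring of the vertices of $G$ with $r$ colors contains, for some $i\in\{1,\dots,p\}$, a monochromatic (not necessarily induced) subgraph isomorphic to $H_i$, where monochromatic means that all its vertices have the same color; $G\xrightarrow{r}H$ means $G\xrightarrow{r}\{H\}$. *)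

theory Defs
  imports "Graph_Theory.Graph_Theory"
begin

text \<open>
  A finite simple graph is a record \<open>G\<close> satisfying \<^const>\<open>pair_graph\<close>: a finite,
  loop-free, symmetric digraph without parallel arcs. An edge \<open>xy\<close> is the pair of arcs
  \<open>(x, y)\<close>, \<open>(y, x)\<close>.
\<close>

definition cart_prod ::
    "'a pair_pre_digraph \<Rightarrow> 'b pair_pre_digraph \<Rightarrow> ('a \<times> 'b) pair_pre_digraph" where
  "cart_prod G H = \<lparr> pverts = pverts G \<times> pverts H,
     parcs = {((x1, x2), (y1, y2)) | x1 x2 y1 y2.
       (x1 \<in> pverts G \<and> x2 \<in> pverts H) \<and> (y1 \<in> pverts G \<and> y2 \<in> pverts H) \<and>
       ((x1, y1) \<in> parcs G \<and> x2 = y2 \<or> x1 = y1 \<and> (x2, y2) \<in> parcs H)} \<rparr>"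

definition relabel :: "('a \<Rightarrow> 'b) \<Rightarrow> 'a pair_pre_digraph \<Rightarrow> 'b pair_pre_digraph" where
  "relabel f G = \<lparr> pverts = f ` pverts G, parcs = (\<lambda>(x, y). (f x, f y)) ` parcs G \<rparr>"

text \<open>
  To give all Cartesian powers of \<open>G\<close> the same type, a vertex \<open>((x\<^sub>1, x\<^sub>2), \<dots>, x\<^sub>n)\<close> of the
  \<open>n\<close>-th power is written as the list \<open>[x\<^sub>1, \<dots>, x\<^sub>n]\<close>; up to this renaming
  (see \<open>cart_power_1_iso\<close> and \<open>cart_power_Suc_iso\<close> below) the recursion is
  \<open>G\<^sup>1 = G\<close> and \<open>G\<^sup>n = G\<^sup>n\<^sup>-\<^sup>1 \<box> G\<close>. The value at \<open>n = 0\<close> is a convention.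
\<close>

fun cart_power :: "'a pair_pre_digraph \<Rightarrow> nat \<Rightarrow> 'a list pair_pre_digraph" where
  "cart_power G 0 = \<lparr> pverts = {[]}, parcs = {} \<rparr>"
| "cart_power G (Suc 0) = relabel (\<lambda>x. [x]) G"
| "cart_power G (Suc (Suc n)) =
     relabel (\<lambda>(xs, x). xs @ [x]) (cart_prod (cart_power G (Suc n)) G)"

text \<open>Only meaningful for \<open>m \<ge> 3\<close>.\<close>

definition cycle_graph :: "nat \<Rightarrow> nat pair_pre_digraph" where
  "cycle_graph m = \<lparr> pverts = {..<m},
     parcs = {(i, j). i < m \<and> j < m \<and> (j = (i + 1) mod m \<or> i = (j + 1) mod m)} \<rparr>"

definition proper_coloring :: "'a pair_pre_digraph \<Rightarrow> nat \<Rightarrow> ('a \<Rightarrow> nat) \<Rightarrow> bool" where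
  "proper_coloring G k c \<longleftrightarrow>
     c ` pverts G \<subseteq> {..<k} \<and> (\<forall>(x, y) \<in> parcs G. c x \<noteq> c y)"

definition chromatic_number :: "'a pair_pre_digraph \<Rightarrow> nat" where
  "chromatic_number G = (LEAST k. \<exists>c. proper_coloring G k c)"

definition monochromatic :: "('a \<Rightarrow> nat) \<Rightarrow> 'a pair_pre_digraph \<Rightarrow> bool" where
  "monochromatic c K \<longleftrightarrow> (\<forall>x \<in> pverts K. \<forall>y \<in> pverts K. c x = c y)"

text \<open>
  \<open>arrows r G \<H>\<close> is the vertex-colouring relation of \<open>G\<close> and the family \<open>\<H>\<close> with \<open>r\<close> colours.
  Colourings are arbitrary (not necessarily proper), and \<^const>\<open>subgraph\<close> does not
  require the subgraph to be induced.
\<close>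

definition arrows :: "nat \<Rightarrow> 'a pair_pre_digraph \<Rightarrow> 'b pair_pre_digraph set \<Rightarrow> bool" where
  "arrows r G \<H> \<longleftrightarrow>
     (\<forall>c. c ` pverts G \<subseteq> {..<r} \<longrightarrow> (\<exists>H \<in> \<H>. \<exists>K.
        subgraph (with_proj K) (with_proj G) \<and>
        digraph_iso (with_proj K) (with_proj H) \<and>
        monochromatic c K))"

lemma pair_graphI:
  assumes "finite (pverts G)"
    and "\<And>x y. (x, y) \<in> parcs G \<Longrightarrow>
      x \<in> pverts G \<and> y \<in> pverts G \<and> x \<noteq> y \<and> (y, x) \<in> parcs G"
  shows "pair_graph G"
proof -
  have sub: "parcs G \<subseteq> pverts G \<times> pverts G"
    using assms(2) by auto
  then have "finite (parcs G)"
    using assms(1) by (meson finite_SigmaI finite_subset)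
  with assms sub show ?thesis
    by unfold_locales (auto simp: symmetric_def sym_def)
qed

lemma pair_graphD:
  assumes "pair_graph G"
  shows "finite (pverts G)"
    and "(x, y) \<in> parcs G \<Longrightarrow>
      x \<in> pverts G \<and> y \<in> pverts G \<and> x \<noteq> y \<and> (y, x) \<in> parcs G"
proof -
  interpret pair_graph G by fact
  show "finite (pverts G)" by (rule pair_finite_verts)
  show "x \<in> pverts G \<and> y \<in> pverts G \<and> x \<noteq> y \<and> (y, x) \<in> parcs G" if "(x, y) \<in> parcs G"
    using that in_arcsD1 in_arcsD2 no_loops' pair_sym_arcs
    by (auto simp: symmetric_def dest: symD)
qed

lemma pair_graph_cart_prod:
  assumes "pair_graph G" and "pair_graph H"
  shows "pair_graph (cart_prod G H)"
  using pair_graphD[OF assms(1)] pair_graphD[OF assms(2)]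
  by (intro pair_graphI) (auto simp: cart_prod_def)

lemma pair_graph_relabel:
  assumes "pair_graph G" and inj: "inj_on f (pverts G)"
  shows "pair_graph (relabel f G)"
proof (rule pair_graphI)
  show "finite (pverts (relabel f G))"
    using pair_graphD(1)[OF assms(1)] by (simp add: relabel_def)
  fix x y assume "(x, y) \<in> parcs (relabel f G)"
  then obtain u v where uv: "(u, v) \<in> parcs G" "x = f u" "y = f v"
    by (auto simp: relabel_def)
  have *: "u \<in> pverts G" "v \<in> pverts G" "u \<noteq> v" "(v, u) \<in> parcs G"
    using pair_graphD(2)[OF assms(1) uv(1)] by auto
  have "f u \<noteq> f v"
    using inj * by (auto dest: inj_onD)
  moreover have "(f v, f u) \<in> parcs (relabel f G)"
    unfolding relabel_def using *(4) by (auto intro: rev_image_eqI)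
  ultimately show "x \<in> pverts (relabel f G) \<and> y \<in> pverts (relabel f G) \<and> x \<noteq> y \<and>
      (y, x) \<in> parcs (relabel f G)"
    using * uv by (simp add: relabel_def)
qed

lemma relabel_iso:
  assumes "pair_graph G" and inj: "inj_on f (pverts G)"
  shows "digraph_iso (with_proj G) (with_proj (relabel f G))"
proof -
  let ?h = "\<lparr> iso_verts = f, iso_arcs = \<lambda>(x, y). (f x, f y), iso_head = snd, iso_tail = fst \<rparr>"
  interpret pair_graph G by fact
  have "inj_on (\<lambda>(x, y). (f x, f y)) (parcs G)"
    using inj in_arcsD1 in_arcsD2 by (intro inj_onI) (auto dest: inj_onD)
  then have "pre_digraph.digraph_isomorphism (with_proj G) ?h"
    using inj wf_digraph by (auto simp: pre_digraph.digraph_isomorphism_def)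
  moreover have "with_proj (relabel f G) = app_iso ?h (with_proj G)"
    by (simp add: with_proj_def app_iso_def relabel_def)
  ultimately show ?thesis
    unfolding digraph_iso_def by blast
qed

lemma inj_on_snoc: "inj_on (\<lambda>(xs, x). xs @ [x]) A"
  by (auto intro: inj_onI)

lemma pair_graph_cart_power:
  assumes "pair_graph G"
  shows "pair_graph (cart_power G n)"
  using assms
proof (induction G n rule: cart_power.induct)
  case (1 G)
  show ?case by (rule pair_graphI) auto
next
  case (2 G)
  show ?case
    unfolding cart_power.simps by (rule pair_graph_relabel[OF "2.prems"]) (simp add: inj_on_def)
next
  case (3 G n)
  show ?case
    unfolding cart_power.simps
    by (rule pair_graph_relabel[OF pair_graph_cart_prod[OF "3.IH"[OF "3.prems"] "3.prems"] inj_on_snoc])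
qed

lemma cart_power_1_iso:
  assumes "pair_graph G"
  shows "digraph_iso (with_proj G) (with_proj (cart_power G 1))"
  using relabel_iso[OF assms, of "\<lambda>x. [x]"] by (simp add: inj_on_def)

lemma cart_power_Suc_iso:
  assumes "pair_graph G" and "n \<ge> 1"
  shows "digraph_iso (with_proj (cart_prod (cart_power G n) G)) (with_proj (cart_power G (Suc n)))"
proof -
  obtain k where "n = Suc k"
    using assms(2) by (cases n) auto
  then show ?thesis
    using relabel_iso[OF pair_graph_cart_prod[OF pair_graph_cart_power[OF assms(1)] assms(1)]
        inj_on_snoc] by simp
qed

lemma pair_graph_cycle_graph:
  assumes "m \<ge> 3"
  shows "pair_graph (cycle_graph m)"
proof (rule pair_graphI)
  show "finite (pverts (cycle_graph m))"
    by (simp add: cycle_graph_def)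
  have *: "(i + 1) mod m \<noteq> i" if "i < m" for i
    using that assms by (cases "i + 1 = m") auto
  fix i j assume "(i, j) \<in> parcs (cycle_graph m)"
  then have "i < m" "j < m" "j = (i + 1) mod m \<or> i = (j + 1) mod m"
    unfolding cycle_graph_def by simp_all
  moreover from this have "i \<noteq> j"
    using *[of i] *[of j] by metis
  ultimately show "i \<in> pverts (cycle_graph m) \<and> j \<in> pverts (cycle_graph m) \<and> i \<noteq> j \<and>
      (j, i) \<in> parcs (cycle_graph m)"
    unfolding cycle_graph_def by auto
qed

lemma proper_coloring_chromatic_number:
  assumes "pair_graph G"
  shows "\<exists>c. proper_coloring G (chromatic_number G) c"
proof -
  obtain f where f: "bij_betw f (pverts G) {0..<card (pverts G)}"
    using ex_bij_betw_finite_nat[OF pair_graphD(1)[OF assms]] by blast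
  have "f x \<noteq> f y" if "(x, y) \<in> parcs G" for x y
    using pair_graphD(2)[OF assms that] inj_onD[OF bij_betw_imp_inj_on[OF f], of x y] by blast
  moreover have "f ` pverts G \<subseteq> {..<card (pverts G)}"
    using bij_betw_imp_surj_on[OF f] by auto
  ultimately have "proper_coloring G (card (pverts G)) f"
    unfolding proper_coloring_def by blast
  then show ?thesis
    unfolding chromatic_number_def by (intro LeastI_ex[of "\<lambda>k. \<exists>c. proper_coloring G k c"]) blast
qed

end

theory Submission
  imports Defs "HOL-Library.Ramsey"
begin

text \<open>
  Words over \<open>V = V(G)\<close> of length \<open>n\<close> are the vertices of the \<open>n\<close>-th power, and an edge
  changes one letter along an edge of \<open>G\<close>. Fix an \<open>r\<close>-colouring \<open>c\<close> of the words. Letting one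
  coordinate \<open>j\<close> of a word \<open>w\<close> run through \<open>V\<close> gives a copy of \<open>G\<close>, hence a monochromatic odd
  cycle of length \<open>2i + 1\<close> with \<open>i \<le> l\<close>. It is lengthened by replacing one edge, from
  \<open>w(j := a)\<close> to \<open>w(j := b)\<close>, by a monochromatic path that leaves the fibre over \<open>j\<close>.

  Such a path comes from further coordinates carrying the letters \<open>a\<close> and \<open>b\<close> only. Let \<open>T\<close>
  be a set of coordinates containing \<open>j\<close> on which \<open>w\<close> has, apart from position \<open>j\<close>, a single \<open>b\<close>
  and otherwise \<open>a\<close>. Writing \<open>b\<close> on \<open>S \<subseteq> T\<close> and \<open>a\<close> on \<open>T - S\<close>, the two ends of the edge
  correspond to a singleton \<open>{k}\<close> and the pair \<open>{j, k}\<close>. If the colour of the word depends only on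
  \<open>card S\<close> when \<open>card S\<close> is 1 or 2, then every path
  \<open>{k}, {k, x}, {x}, {x, x'}, \<dots>, {j}, {j, k}\<close> is monochromatic, since its ends have the same
  colour. A path through \<open>q \<ge> 3\<close> elements of \<open>T\<close> has \<open>2q - 1\<close> edges, so the cycle gets longer by
  \<open>2q - 2\<close>, which can be any even number from 4 on if \<open>T\<close> is large enough. (An increase by 2 would
  need a 4-cycle in the layers 1 and 2, and there is none; this is where \<open>s \<ge> l + 2\<close> comes from.)
  Taking \<open>q = s - i + 1\<close> gives length \<open>2s + 1\<close>.

  It is unknown in advance which edge \<open>(a, b)\<close> the monochromatic cycle uses, so a single pair
  \<open>(w, j)\<close> must have a suitable \<open>T\<close> for all edges at once (\<open>flexible\<close>). For one edge, Ramsey's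
  theorem for singletons and pairs suffices. Edges are added one at a time. If a flexible coordinate
  can be found for the edge set \<open>E\<close>, then arbitrarily many coordinates can be found that stay
  flexible for \<open>E\<close> whatever letters the others carry: work in disjoint blocks and
  colour the words of one block by the function that maps the rest of the word to its colour
  (\<open>unavoidable_blocks\<close>). Ramsey's theorem inside this large set of coordinates then
  adds the next edge (\<open>unavoidable_insert\<close>).

  For the second claim, if no colour class of an \<open>r\<close>-colouring contained an odd cycle, each class
  would be bipartite and \<open>G\<close> would be \<open>2r\<close>-colourable. An odd cycle has length at most \<open>m\<close>, so the
  first claim applies with \<open>l = s - 2\<close>.
\<close>

section \<open>Cycles in graphs and Cartesian powers\<close>

definition is_cycle :: "('a \<times> 'a) set \<Rightarrow> nat \<Rightarrow> (nat \<Rightarrow> 'a) \<Rightarrow> bool" where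
  "is_cycle E m y \<longleftrightarrow> inj_on y {..<m} \<and> (\<forall>i<m. (y i, y (Suc i mod m)) \<in> E)"

lemma is_cycle_edge: "is_cycle E m y \<Longrightarrow> i < m \<Longrightarrow> (y i, y (Suc i mod m)) \<in> E"
  by (simp add: is_cycle_def)

lemma pair_graph_wf: "pair_graph G \<Longrightarrow> wf_digraph (with_proj G)"
proof -
  assume "pair_graph G"
  then interpret pair_graph G .
  show ?thesis by (rule wf_digraph)
qed

text \<open>
  Isomorphic copies of a cycle are the same thing as cyclic enumerations of vertices; in this form
  cycles can be cut and glued.
\<close>

lemma mono_cycle_subgraph_iff:
  assumes G: "pair_graph G" and m: "m \<ge> 3"
  shows "(\<exists>K. subgraph (with_proj K) (with_proj G) \<and>
      digraph_iso (with_proj K) (with_proj (cycle_graph m)) \<and> Defs.monochromatic c K) \<longleftrightarrow>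
    (\<exists>y. is_cycle (parcs G) m y \<and> (\<forall>i<m. c (y i) = c (y 0)))" (is "?L \<longleftrightarrow> ?R")
proof
  assume ?L
  then obtain K where K: "subgraph (with_proj K) (with_proj G)"
    "digraph_iso (with_proj K) (with_proj (cycle_graph m))" "Defs.monochromatic c K" by blast
  then have "digraph_iso (with_proj (cycle_graph m)) (with_proj K)"
    by (auto simp: subgraph_def intro: digraph_iso_swap)
  then obtain f where f: "pre_digraph.digraph_isomorphism (with_proj (cycle_graph m)) f"
    and Kf: "with_proj K = app_iso f (with_proj (cycle_graph m))"
    unfolding digraph_iso_def by blast
  let ?y = "iso_verts f"
  have Kv: "pverts K = ?y ` {..<m}" and Ka: "parcs K = iso_arcs f ` parcs (cycle_graph m)"
    and Kt: "iso_tail f = fst" and Kh: "iso_head f = snd"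
    using Kf by (simp_all add: with_proj_def app_iso_def cycle_graph_def)
  have inj: "inj_on ?y {..<m}"
    using f by (simp add: pre_digraph.digraph_isomorphism_def cycle_graph_def)
  have edge: "(?y i, ?y (Suc i mod m)) \<in> parcs G" if "i < m" for i
  proof -
    let ?e = "(i, Suc i mod m)"
    have e: "?e \<in> parcs (cycle_graph m)"
      using that m by (simp add: cycle_graph_def)
    then have "iso_arcs f ?e \<in> parcs K" using Ka by blast
    then have "iso_arcs f ?e \<in> parcs G"
      using K(1) by (auto simp: subgraph_def)
    moreover have "fst (iso_arcs f ?e) = ?y i" "snd (iso_arcs f ?e) = ?y (Suc i mod m)"
      using f e Kt Kh by (force simp: pre_digraph.digraph_isomorphism_def)+
    ultimately show ?thesis by (metis prod.collapse)
  qed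
  have "c (?y i) = c (?y 0)" if "i < m" for i
  proof -
    have "?y i \<in> pverts K" "?y 0 \<in> pverts K"
      using that Kv by auto
    then show ?thesis
      using K(3) unfolding Defs.monochromatic_def by blast
  qed
  then show ?R
    using inj edge unfolding is_cycle_def by blast
next
  assume ?R
  then obtain y where y: "inj_on y {..<m}" "\<And>i. i < m \<Longrightarrow> (y i, y (Suc i mod m)) \<in> parcs G"
    and mono: "\<And>i. i < m \<Longrightarrow> c (y i) = c (y 0)"
    unfolding is_cycle_def by blast
  let ?K = "relabel y (cycle_graph m)"
  have inj: "inj_on y (pverts (cycle_graph m))"
    using y(1) by (simp add: cycle_graph_def)
  have K: "pair_graph ?K"
    by (rule pair_graph_relabel[OF pair_graph_cycle_graph[OF m] inj])
  have "digraph_iso (with_proj ?K) (with_proj (cycle_graph m))"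
    by (rule digraph_iso_swap[OF pair_graph_wf[OF pair_graph_cycle_graph[OF m]]
          relabel_iso[OF pair_graph_cycle_graph[OF m] inj]])
  moreover have "subgraph (with_proj ?K) (with_proj G)"
    unfolding subgraph_def
  proof (intro conjI)
    show "verts (with_proj ?K) \<subseteq> verts (with_proj G)"
      using pair_graphD(2)[OF G y(2)] by (auto simp: relabel_def cycle_graph_def)
    show "arcs (with_proj ?K) \<subseteq> arcs (with_proj G)"
      using y(2) pair_graphD(2)[OF G y(2)] by (auto simp: relabel_def cycle_graph_def)
  qed (use G K in \<open>auto intro: pair_graph_wf\<close>)
  moreover have "Defs.monochromatic c ?K"
  proof -
    have "\<exists>i<m. x = y i" if "x \<in> pverts ?K" for x
      using that by (auto simp: relabel_def cycle_graph_def)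
    then have "c x = c (y 0)" if "x \<in> pverts ?K" for x
      using mono that by metis
    then show ?thesis
      unfolding Defs.monochromatic_def by metis
  qed
  ultimately show ?L by blast
qed

lemma arrows_cycles_iff:
  assumes "pair_graph G" and "\<And>m. m \<in> L \<Longrightarrow> m \<ge> 3"
  shows "arrows r G (cycle_graph ` L) \<longleftrightarrow>
    (\<forall>c. c ` pverts G \<subseteq> {..<r} \<longrightarrow>
      (\<exists>m \<in> L. \<exists>y. is_cycle (parcs G) m y \<and> (\<forall>i<m. c (y i) = c (y 0))))"
proof -
  have "(\<exists>H \<in> cycle_graph ` L. \<exists>K. subgraph (with_proj K) (with_proj G) \<and>
        digraph_iso (with_proj K) (with_proj H) \<and> Defs.monochromatic c K) \<longleftrightarrow>
      (\<exists>m \<in> L. \<exists>y. is_cycle (parcs G) m y \<and> (\<forall>i<m. c (y i) = c (y 0)))" for c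
    unfolding bex_simps(7)
    by (rule bex_cong[OF refl]) (rule mono_cycle_subgraph_iff[OF assms])
  then show ?thesis
    unfolding arrows_def by (simp only:)
qed

lemma pverts_cart_power: "pverts (cart_power G n) = {xs. length xs = n \<and> set xs \<subseteq> pverts G}"
proof (induction G n rule: cart_power.induct)
  case (1 G)
  show ?case by auto
next
  case (2 G)
  show ?case by (auto simp: relabel_def length_Suc_conv)
next
  case (3 G n)
  show ?case (is "?L = ?R")
  proof
    show "?L \<subseteq> ?R"
      using 3 by (auto simp: relabel_def cart_prod_def)
    show "?R \<subseteq> ?L"
    proof
      fix xs assume xs: "xs \<in> ?R"
      then obtain ys x where "xs = ys @ [x]"
        by (cases xs rule: rev_cases) auto
      then show "xs \<in> ?L"
        using xs 3 by (force simp: relabel_def cart_prod_def)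
    qed
  qed
qed

text \<open>
  Functions on \<open>nat\<close> in place of lists make it possible to change single letters by function update;
  the list of the first \<open>n\<close> values recovers the vertex of the power.
\<close>

lemma parcs_cart_power:
  assumes "pair_graph G" and "j < n" and "(w j, w' j) \<in> parcs G"
    and "\<And>i. i \<noteq> j \<Longrightarrow> w i = w' i" and "\<And>i. i < n \<Longrightarrow> w i \<in> pverts G"
  shows "(map w [0..<n], map w' [0..<n]) \<in> parcs (cart_power G n)"
  using assms
proof (induction G n rule: cart_power.induct)
  case (1 G)
  then show ?case by simp
next
  case (2 G)
  then show ?case by (auto simp: relabel_def intro!: rev_image_eqI)
next
  case (3 G n)
  let ?N = "Suc n"
  have w': "w' i \<in> pverts G" if "i < Suc ?N" for i
    using 3(6)[OF that] 3(5)[of i] pair_graphD(2)[OF 3(2) 3(4)] by (cases "i = j") auto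
  have verts: "map w [0..<?N] \<in> pverts (cart_power G ?N)" "map w' [0..<?N] \<in> pverts (cart_power G ?N)"
    using 3(6) w' by (auto simp: pverts_cart_power)
  have "((map w [0..<?N], w ?N), (map w' [0..<?N], w' ?N)) \<in> parcs (cart_prod (cart_power G ?N) G)"
  proof (cases "j = ?N")
    case True
    then have "map w [0..<?N] = map w' [0..<?N]"
      using 3(5) by auto
    then show ?thesis
      using verts w' 3(4,6) True unfolding cart_prod_def by auto
  next
    case False
    then have "(map w [0..<?N], map w' [0..<?N]) \<in> parcs (cart_power G ?N)"
      using 3 by (intro "3.IH") auto
    moreover have "w ?N = w' ?N"
      using False 3(5)[of ?N] by simp
    ultimately show ?thesis
      using verts w' 3(6) unfolding cart_prod_def by auto
  qed
  then show ?case
    by (force simp: relabel_def)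
qed

section \<open>Odd cycles and the chromatic number\<close>

text \<open>
  Without an odd closed walk, the parity of the length of a walk from a root of the component
  is a proper 2-colouring. So some odd closed walk exists, and a shortest one has no repeated vertex:
  a repetition would split it into two closed walks, one of them odd and shorter.
\<close>

lemma odd_cycle_of_not_two_colourable:
  assumes sym: "\<And>x y. (x, y) \<in> E \<Longrightarrow> (y, x) \<in> E" and irr: "\<And>x. (x, x) \<notin> E"
    and not2: "\<nexists>f :: 'a \<Rightarrow> bool. \<forall>(x, y) \<in> E. f x \<noteq> f y"
  obtains i y where "i \<ge> 1" and "is_cycle E (2 * i + 1) y"
proof -
  have ex: "\<exists>n. odd n \<and> (\<exists>z. (z, z) \<in> E ^^ n)"
  proof (rule ccontr)
    assume no: "\<not> ?thesis"
    have symp: "(x, y) \<in> E ^^ n \<Longrightarrow> (y, x) \<in> E ^^ n" for x y n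
    proof (induction n arbitrary: x y)
      case (Suc n)
      then obtain u where "(x, u) \<in> E ^^ n" "(u, y) \<in> E" by auto
      then show ?case using Suc.IH sym by (metis relpow_Suc_I2)
    qed simp
    \<comment> \<open>Adjacent vertices lie in the same component, so the choice gives them the same root.\<close>
    define root where "root x = (SOME u. (u, x) \<in> E\<^sup>*)" for x
    have root: "(root x, x) \<in> E\<^sup>*" for x
      unfolding root_def by (rule someI[of _ x]) simp
    have root_eq: "root x = root y" if "(x, y) \<in> E" for x y
    proof -
      have "(u, x) \<in> E\<^sup>* \<longleftrightarrow> (u, y) \<in> E\<^sup>*" for u
        using that sym by (meson rtrancl.rtrancl_into_rtrancl)
      then show ?thesis by (simp add: root_def)
    qed
    define f where "f x \<longleftrightarrow> (\<exists>n. even n \<and> (root x, x) \<in> E ^^ n)" for x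
    have "f x \<noteq> f y" if xy: "(x, y) \<in> E" for x y
    proof
      assume eq: "f x = f y"
      obtain p q where p: "(root x, x) \<in> E ^^ p" and q: "(root y, y) \<in> E ^^ q" and pq: "even p = even q"
        using eq root[of x] root[of y] unfolding f_def by (metis rtrancl_imp_relpow)
      have "(root x, y) \<in> E ^^ Suc p"
        using p xy by auto
      then have "(root x, root x) \<in> E ^^ (Suc p + q)"
        using relcompI[OF _ symp[OF q]] root_eq[OF xy] unfolding relpow_add by metis
      then show False
        using no pq by (metis even_Suc even_add add_Suc)
    qed
    then show False using not2 by blast
  qed
  define n where "n = (LEAST n. odd n \<and> (\<exists>z. (z, z) \<in> E ^^ n))"
  have n: "odd n" "\<exists>z. (z, z) \<in> E ^^ n"
    using LeastI_ex[OF ex] unfolding n_def by auto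
  have least: "n \<le> k" if "odd k" "(z, z) \<in> E ^^ k" for k z
    unfolding n_def by (rule Least_le) (use that in blast)
  obtain y where y: "y 0 = y n" "\<And>i. i < n \<Longrightarrow> (y i, y (Suc i)) \<in> E"
    using n(2) unfolding relpow_fun_conv by metis
  have sub: "(y p, y q) \<in> E ^^ (q - p)" if "p \<le> q" "q \<le> n" for p q
    unfolding relpow_fun_conv using that y(2) by (intro exI[of _ "\<lambda>i. y (p + i)"]) auto
  have "y p \<noteq> y q" if "p < q" "q < n" for p q
  proof
    assume eq: "y p = y q"
    have A: "(y p, y p) \<in> E ^^ (q - p)"
      using sub[of p q] that eq by simp
    have "(y q, y p) \<in> E ^^ ((n - q) + p)"
      using relcompI[OF sub[of q n] sub[of 0 p, unfolded y(1)]] that unfolding relpow_add by simp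
    then have B: "(y p, y p) \<in> E ^^ ((n - q) + p)"
      using eq by simp
    have "odd (q - p) \<or> odd ((n - q) + p)"
    proof -
      have "(q - p) + ((n - q) + p) = n"
        using that by simp
      then show ?thesis
        using n(1) by (metis even_add)
    qed
    then show False
    proof
      assume "odd (q - p)"
      then show False using least[OF _ A] that by simp
    next
      assume "odd ((n - q) + p)"
      then have "n \<le> (n - q) + p" by (rule least[OF _ B])
      then show False using that by simp
    qed
  qed
  then have inj: "inj_on y {..<n}"
    by (intro inj_onI) (metis lessThan_iff linorder_neqE_nat)
  have step: "(y i, y (Suc i mod n)) \<in> E" if "i < n" for i
    using y(2)[OF that] y(1) that by (cases "Suc i = n") auto
  obtain i where i: "n = 2 * i + 1"
    using n(1) by (rule oddE)
  \<comment> \<open>Length 1 would be a loop.\<close>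
  have "i \<noteq> 0"
  proof
    assume "i = 0"
    then have "(y 0, y 0) \<in> E"
      using step[of 0] i by simp
    then show False using irr by blast
  qed
  then show thesis
    using that[of i y] i inj step unfolding is_cycle_def by simp
qed

text \<open>
  If every colour class were bipartite, splitting each colour into two would give a proper colouring
  with \<open>2r\<close> colours. The relation of monochromatic edges treats all colour classes at once.
\<close>

lemma monochromatic_odd_cycle:
  assumes G: "pair_graph G" and chi: "chromatic_number G > 2 * r" and c: "c ` pverts G \<subseteq> {..<r}"
  obtains i y where "i \<ge> 1" and "is_cycle (parcs G) (2 * i + 1) y"
    and "\<And>k. k < 2 * i + 1 \<Longrightarrow> c (y k) = c (y 0)"
proof -
  let ?E = "{(x, y). (x, y) \<in> parcs G \<and> c x = c y}"
  have not2: "\<nexists>f :: 'a \<Rightarrow> bool. \<forall>(x, y) \<in> ?E. f x \<noteq> f y"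
  proof
    assume "\<exists>f :: 'a \<Rightarrow> bool. \<forall>(x, y) \<in> ?E. f x \<noteq> f y"
    then obtain f :: "'a \<Rightarrow> bool" where f: "\<And>x y. (x, y) \<in> parcs G \<Longrightarrow> c x = c y \<Longrightarrow> f x \<noteq> f y"
      by blast
    let ?c = "\<lambda>x. 2 * c x + (if f x then 1 else 0)"
    have "proper_coloring G (2 * r) ?c"
      unfolding proper_coloring_def
    proof (intro conjI ballI)
      show "?c ` pverts G \<subseteq> {..<2 * r}"
        using c by (fastforce simp: image_subset_iff)
      show "case e of (x, y) \<Rightarrow> ?c x \<noteq> ?c y" if "e \<in> parcs G" for e
      proof (cases e)
        case (Pair x y)
        then have *: "c x = c y \<Longrightarrow> f x \<noteq> f y" using f that by blast
        have "?c x \<noteq> ?c y"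
        proof
          assume eq: "?c x = ?c y"
          then have "?c x div 2 = ?c y div 2" by simp
          then have "c x = c y" by (simp split: if_splits)
          then show False using * eq by (simp split: if_splits)
        qed
        then show ?thesis using Pair by simp
      qed
    qed
    then have "chromatic_number G \<le> 2 * r"
      unfolding chromatic_number_def by (intro Least_le) blast
    then show False using chi by simp
  qed
  obtain i y where i: "i \<ge> 1" and y: "is_cycle ?E (2 * i + 1) y"
    by (rule odd_cycle_of_not_two_colourable[of ?E]) (use pair_graphD(2)[OF G] not2 in auto)
  have edge: "(y k, y (Suc k mod (2 * i + 1))) \<in> parcs G"
    and same: "c (y k) = c (y (Suc k mod (2 * i + 1)))" if "k < 2 * i + 1" for k
    using y that unfolding is_cycle_def by blast+
  have "c (y k) = c (y 0)" if "k < 2 * i + 1" for k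
    using that
  proof (induction k)
    case (Suc k)
    then show ?case
      using same[of k] by simp
  qed simp
  moreover have "is_cycle (parcs G) (2 * i + 1) y"
    using y edge unfolding is_cycle_def by blast
  ultimately show thesis using that i by blast
qed

section \<open>Flexible positions in coloured words\<close>

text \<open>
  Ramsey's theorem carried over from the set of the first \<open>N\<close> numbers to any set of \<open>N\<close> elements.
\<close>

lemma homogeneous_subset:
  fixes J :: "'b set"
  assumes N: "partn_lst {..<N} (replicate r t) g"
    and J: "finite J" "card J = N" and f: "\<And>S. S \<in> nsets J g \<Longrightarrow> f S < r"
  obtains T i where "T \<in> nsets J t" and "\<And>S. S \<in> nsets T g \<Longrightarrow> f S = i"
proof -
  obtain h where h: "bij_betw h {..<N} J"
    using J ex_bij_betw_nat_finite[of J] by (auto simp: atLeast0LessThan)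
  have inj: "inj_on h {..<N}" and im: "h ` {..<N} = J"
    using h by (auto simp: bij_betw_def)
  have img: "h ` S \<in> nsets (h ` A) k" if "S \<in> nsets A k" "A \<subseteq> {..<N}" for S A k
    using that inj by (auto simp: nsets_def card_image inj_on_subset)
  have "(\<lambda>S. f (h ` S)) \<in> nsets {..<N} g \<rightarrow> {..<r}"
    using f img[of _ "{..<N}"] im by auto
  then obtain i H where H: "i < r" "H \<in> nsets {..<N} t" "(\<lambda>S. f (h ` S)) ` nsets H g \<subseteq> {i}"
    using partn_lstE[OF N, of _ r] by (metis length_replicate nth_replicate)
  have "f S = i" if S: "S \<in> nsets (h ` H) g" for S
  proof -
    have injH: "inj_on h H"
      using H(2) inj by (auto simp: nsets_def inj_on_subset)
    obtain Y where "Y \<in> nsets H g" "S = h ` Y"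
      by (rule nset_image_obtains[OF S injH])
    then show "f S = i"
      using H(3) by auto
  qed
  then show ?thesis
    using img[OF H(2)] im that by auto
qed

text \<open>
  Words with positions in \<open>I\<close>. The fixed letter \<open>z\<close> outside \<open>I\<close> makes words over \<open>I\<close> functions on
  all of \<open>nat\<close>, so that the position set can grow without a change of type.
\<close>

definition words :: "'a set \<Rightarrow> 'a \<Rightarrow> nat set \<Rightarrow> (nat \<Rightarrow> 'a) set" where
  "words V z I = {w. \<forall>i. (i \<in> I \<longrightarrow> w i \<in> V) \<and> (i \<notin> I \<longrightarrow> w i = z)}"

lemma finite_words: "finite V \<Longrightarrow> finite I \<Longrightarrow> finite (words V z I)"
  unfolding words_def by (rule finite_set_of_finite_funs)

definition place :: "'a \<Rightarrow> 'a \<Rightarrow> nat set \<Rightarrow> nat set \<Rightarrow> (nat \<Rightarrow> 'a) \<Rightarrow> nat \<Rightarrow> 'a" where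
  "place a b T S w = (\<lambda>i. if i \<in> T then (if i \<in> S then b else a) else w i)"

text \<open>
  The configuration that allows detours around the edge \<open>e = (a, b)\<close> at position \<open>j\<close>.
  On \<open>T\<close> apart from \<open>j\<close>, the word \<open>w\<close> has a single \<open>b\<close>, at \<open>k\<close>, and \<open>a\<close> elsewhere; hence
  \<open>w(j := a)\<close> and \<open>w(j := b)\<close> are the words with \<open>b\<close> placed on \<open>{k}\<close> and on \<open>{j, k}\<close>.
\<close>

definition flexible :: "nat \<Rightarrow> ((nat \<Rightarrow> 'a) \<Rightarrow> nat) \<Rightarrow> (nat \<Rightarrow> 'a) \<Rightarrow> nat \<Rightarrow> 'a \<times> 'a \<Rightarrow> nat set \<Rightarrow> bool" where
  "flexible t c w j e T \<longleftrightarrow> (case e of (a, b) \<Rightarrow>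
     card T = t \<and> j \<in> T \<and>
     (\<exists>k \<in> T. k \<noteq> j \<and> w k = b \<and> (\<forall>i \<in> T - {j, k}. w i = a)) \<and>
     (\<forall>g \<in> {1, 2}. \<forall>S \<in> nsets T g. \<forall>S' \<in> nsets T g. c (place a b T S w) = c (place a b T S' w)))"

text \<open>
  The quantification over \<open>u\<close> demands that each of the \<open>M\<close> positions in \<open>J\<close> stays flexible for
  all edges in \<open>E\<close> when the letters on \<open>J\<close> are changed arbitrarily. The set \<open>T\<close> may depend on
  these letters.
\<close>

definition forces :: "'a set \<Rightarrow> 'a \<Rightarrow> nat \<Rightarrow> ('a \<times> 'a) set \<Rightarrow> nat \<Rightarrow> nat \<Rightarrow> nat set \<Rightarrow> bool" where
  "forces V z t E M r I \<longleftrightarrow>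
     (\<forall>c. (\<forall>x \<in> words V z I. c x < r) \<longrightarrow>
        (\<exists>w \<in> words V z I. \<exists>J \<subseteq> I. card J = M \<and>
           (\<forall>u \<in> words V z I. (\<forall>i. i \<notin> J \<longrightarrow> u i = w i) \<longrightarrow>
              (\<forall>j \<in> J. \<forall>e \<in> E. \<exists>T \<subseteq> I. flexible t c u j e T))))"

lemma forcesE:
  assumes "forces V z t E M r I" and "\<And>x. x \<in> words V z I \<Longrightarrow> c x < r"
  obtains w J where "w \<in> words V z I" and "J \<subseteq> I" and "card J = M"
    and "\<And>u j e. u \<in> words V z I \<Longrightarrow> (\<And>i. i \<notin> J \<Longrightarrow> u i = w i) \<Longrightarrow> j \<in> J \<Longrightarrow> e \<in> E \<Longrightarrow>
      \<exists>T \<subseteq> I. flexible t c u j e T"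
proof -
  obtain w J where "w \<in> words V z I" "J \<subseteq> I" "card J = M"
    and *: "\<forall>u \<in> words V z I. (\<forall>i. i \<notin> J \<longrightarrow> u i = w i) \<longrightarrow>
              (\<forall>j \<in> J. \<forall>e \<in> E. \<exists>T \<subseteq> I. flexible t c u j e T)"
    using assms unfolding forces_def by blast
  then show thesis
    by (intro that[of w J]) simp_all
qed

text \<open>
  The finite set \<open>F\<close> to be avoided allows position sets to be chosen disjoint from earlier ones,
  with a number of colours that depends on the earlier ones.
\<close>

definition unavoidable :: "'a set \<Rightarrow> 'a \<Rightarrow> nat \<Rightarrow> ('a \<times> 'a) set \<Rightarrow> nat \<Rightarrow> bool" where
  "unavoidable V z t E M \<longleftrightarrow>
     (\<forall>r F. finite F \<longrightarrow> (\<exists>I. finite I \<and> I \<inter> F = {} \<and> forces V z t E M r I))"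

lemma unavoidableE:
  assumes "unavoidable V z t E M" and "finite F"
  obtains I where "finite I" and "I \<inter> F = {}" and "forces V z t E M r I"
proof -
  have "\<exists>I. finite I \<and> I \<inter> F = {} \<and> forces V z t E M r I"
    using assms unfolding unavoidable_def by simp
  then show thesis
    using that by (elim exE conjE)
qed

text \<open>
  The colours of \<open>h\<close> encode functions from \<open>Y\<close> to the \<open>r\<close> old colours; an invariance of \<open>h\<close> is an
  invariance of all colourings \<open>\<lambda>x. f x y\<close> at once.
\<close>

lemma bundle_colours:
  fixes f :: "'x \<Rightarrow> 'y \<Rightarrow> nat"
  assumes "finite Y" and "\<And>x y. x \<in> X \<Longrightarrow> y \<in> Y \<Longrightarrow> f x y < r"
  shows "\<exists>h :: 'x \<Rightarrow> nat. (\<forall>x \<in> X. h x < r ^ card Y) \<and>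
    (\<forall>x \<in> X. \<forall>x' \<in> X. h x = h x' \<longrightarrow> (\<forall>y \<in> Y. f x y = f x' y))"
proof -
  let ?P = "Y \<rightarrow>\<^sub>E {..<r}"
  have P: "finite ?P" "card ?P = r ^ card Y"
    using assms(1) by (auto simp: finite_PiE card_PiE)
  then obtain g where g: "bij_betw g ?P {..<r ^ card Y}"
    using ex_bij_betw_finite_nat[of ?P] by (auto simp: atLeast0LessThan)
  have mem: "restrict (f x) Y \<in> ?P" if "x \<in> X" for x
    using assms(2)[OF that] by auto
  have "g (restrict (f x) Y) < r ^ card Y" if "x \<in> X" for x
    using bij_betwE[OF g] mem[OF that] by auto
  moreover have "f x y = f x' y"
    if "x \<in> X" "x' \<in> X" "g (restrict (f x) Y) = g (restrict (f x') Y)" "y \<in> Y" for x x' y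
  proof -
    have "restrict (f x) Y = restrict (f x') Y"
      by (rule inj_onD[OF bij_betw_imp_inj_on[OF g]]) (use that mem in auto)
    then show ?thesis using \<open>y \<in> Y\<close> by (metis restrict_apply')
  qed
  ultimately show ?thesis
    by (intro exI[of _ "\<lambda>x. g (restrict (f x) Y)"]) blast
qed

lemma unavoidable_empty:
  assumes "z \<in> V"
  shows "unavoidable V z t {} 1"
  unfolding unavoidable_def
proof (intro allI impI)
  fix r :: nat and F :: "nat set" assume "finite F"
  then obtain i where "i \<notin> F"
    using ex_new_if_finite by auto
  moreover have "forces V z t {} 1 r {i}"
    unfolding forces_def
  proof (intro allI impI)
    have "(\<lambda>_. z) \<in> words V z {i}"
      using assms by (simp add: words_def)
    then show "\<exists>w \<in> words V z {i}. \<exists>J \<subseteq> {i}. card J = 1 \<and>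
        (\<forall>u \<in> words V z {i}. (\<forall>i. i \<notin> J \<longrightarrow> u i = w i) \<longrightarrow>
           (\<forall>j \<in> J. \<forall>e \<in> {}. \<exists>T \<subseteq> {i}. flexible t c u j e T))" for c
      by (intro bexI[of _ "\<lambda>_. z"] exI[of _ "{i}"]) simp_all
  qed
  ultimately show "\<exists>I. finite I \<and> I \<inter> F = {} \<and> forces V z t {} 1 r I"
    by (intro exI[of _ "{i}"]) simp
qed

lemma place_in_words:
  assumes "w \<in> words V z I" "T \<subseteq> I" "a \<in> V" "b \<in> V"
  shows "place a b T S w \<in> words V z I"
  using assms by (auto simp: words_def place_def)

lemma flexible_transfer:
  assumes "flexible t h x j (a, b) T" and "\<And>i. i \<in> T \<Longrightarrow> u i = x i"
    and "\<And>S S'. h (place a b T S x) = h (place a b T S' x) \<Longrightarrow>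
      c (place a b T S u) = c (place a b T S' u)"
  shows "flexible t c u j (a, b) T"
proof -
  from assms(1) obtain k where k: "k \<in> T" "k \<noteq> j" "x k = b" "\<forall>i \<in> T - {j, k}. x i = a"
    and *: "card T = t" "j \<in> T"
      "\<And>g S S'. g \<in> {1, 2} \<Longrightarrow> S \<in> nsets T g \<Longrightarrow> S' \<in> nsets T g \<Longrightarrow>
         h (place a b T S x) = h (place a b T S' x)"
    unfolding flexible_def prod.case by blast
  show ?thesis
    unfolding flexible_def prod.case
  proof (intro conjI bexI[of _ k] ballI)
    show "c (place a b T S u) = c (place a b T S' u)"
      if "g \<in> {1, 2}" "S \<in> nsets T g" "S' \<in> nsets T g" for g S S'
      by (rule assms(3)[OF *(3)[OF that]])
  qed (use *(1,2) k assms(2) in auto)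
qed

text \<open>
  The new position is found in a block \<open>B\<close> of coordinates disjoint from the block \<open>A\<close> that provides
  the other \<open>M\<close>. In \<open>B\<close> a word is coloured by the function from words over \<open>A\<close> to colours, so that
  the position \<open>j\<close> found there is flexible whatever stands on \<open>A\<close>. After \<open>B\<close> is fixed up to the
  letter at \<open>j\<close>, words over \<open>A\<close> are coloured by the function from that letter to colours. The number
  of colours used for \<open>B\<close> depends on \<open>A\<close>, hence \<open>A\<close> is chosen first.
\<close>

lemma unavoidable_blocks:
  assumes "finite V" and "z \<in> V" and E: "E \<subseteq> V \<times> V" and one: "unavoidable V z t E 1"
  shows "unavoidable V z t E M"
proof (induction M)
  case 0
  have "(\<lambda>_. z) \<in> words V z {}"
    by (simp add: words_def)
  then have "forces V z t E 0 r {}" for r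
    unfolding forces_def by (intro allI impI bexI[of _ "\<lambda>_. z"] exI[of _ "{}"]) simp_all
  then show ?case
    unfolding unavoidable_def by blast
next
  case (Suc M)
  show ?case
    unfolding unavoidable_def
  proof (intro allI impI)
    fix r :: nat and F :: "nat set" assume F: "finite F"
    obtain A where A: "finite A" "A \<inter> F = {}" and forceA: "forces V z t E M (r ^ card V) A"
      using unavoidableE[OF Suc.IH F] .
    have FA: "finite (F \<union> A)"
      using F A by simp
    obtain B where B: "finite B" "B \<inter> (F \<union> A) = {}"
      and forceB: "forces V z t E 1 (r ^ card (words V z A)) B"
      using unavoidableE[OF one FA] .
    let ?I = "A \<union> B"
    define join :: "(nat \<Rightarrow> 'a) \<Rightarrow> (nat \<Rightarrow> 'a) \<Rightarrow> nat \<Rightarrow> 'a"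
      where "join x y = (\<lambda>i. if i \<in> A then x i else y i)" for x y
    have join_words: "join x y \<in> words V z ?I" if "x \<in> words V z A" "y \<in> words V z B" for x y
      using that by (auto simp: join_def words_def)
    have "forces V z t E (Suc M) r ?I"
      unfolding forces_def
    proof (intro allI impI)
      fix c assume c: "\<forall>x \<in> words V z ?I. c x < r"
      have c_join: "c (join x y) < r" if "y \<in> words V z B" "x \<in> words V z A" for x y
        using c join_words that by blast
      have "\<exists>h. (\<forall>y \<in> words V z B. h y < r ^ card (words V z A)) \<and>
          (\<forall>y \<in> words V z B. \<forall>y' \<in> words V z B. h y = h y' \<longrightarrow>
            (\<forall>x \<in> words V z A. c (join x y) = c (join x y')))"
        by (rule bundle_colours[OF finite_words[OF \<open>finite V\<close> A(1)]]) (rule c_join)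
      then obtain hB where hB: "\<forall>y \<in> words V z B. hB y < r ^ card (words V z A)"
        and hB_eq: "\<forall>y \<in> words V z B. \<forall>y' \<in> words V z B. hB y = hB y' \<longrightarrow>
          (\<forall>x \<in> words V z A. c (join x y) = c (join x y'))"
        by (elim exE conjE)
      obtain wB JB where wB: "wB \<in> words V z B" and JB: "JB \<subseteq> B" "card JB = 1"
        and flexB: "\<And>u j e. u \<in> words V z B \<Longrightarrow> (\<And>i. i \<notin> JB \<Longrightarrow> u i = wB i) \<Longrightarrow>
          j \<in> JB \<Longrightarrow> e \<in> E \<Longrightarrow> \<exists>T \<subseteq> B. flexible t hB u j e T"
        by (rule forcesE[OF forceB, of hB]) (use hB in blast)+
      obtain j where j: "JB = {j}"
        using JB(2) by (rule card_1_singletonE)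
      have wBj: "wB(j := v) \<in> words V z B" if "v \<in> V" for v
        using wB that j JB by (auto simp: words_def)
      have c_joinj: "c (join x (wB(j := v))) < r" if "x \<in> words V z A" "v \<in> V" for x v
        by (rule c_join[OF wBj[OF that(2)] that(1)])
      have "\<exists>h. (\<forall>x \<in> words V z A. h x < r ^ card V) \<and>
          (\<forall>x \<in> words V z A. \<forall>x' \<in> words V z A. h x = h x' \<longrightarrow>
            (\<forall>v \<in> V. c (join x (wB(j := v))) = c (join x' (wB(j := v)))))"
        by (rule bundle_colours[OF \<open>finite V\<close>]) (rule c_joinj)
      then obtain hA where hA: "\<forall>x \<in> words V z A. hA x < r ^ card V"
        and hA_eq: "\<forall>x \<in> words V z A. \<forall>x' \<in> words V z A. hA x = hA x' \<longrightarrow>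
          (\<forall>v \<in> V. c (join x (wB(j := v))) = c (join x' (wB(j := v))))"
        by (elim exE conjE)
      obtain wA JA where wA: "wA \<in> words V z A" and JA: "JA \<subseteq> A" "card JA = M"
        and flexA: "\<And>u j e. u \<in> words V z A \<Longrightarrow> (\<And>i. i \<notin> JA \<Longrightarrow> u i = wA i) \<Longrightarrow>
          j \<in> JA \<Longrightarrow> e \<in> E \<Longrightarrow> \<exists>T \<subseteq> A. flexible t hA u j e T"
        by (rule forcesE[OF forceA, of hA]) (use hA in blast)+
      have jA: "j \<notin> A" "j \<in> B"
        using j JB(1) B(2) by auto
      have BA: "i \<notin> A" if "i \<in> B" for i
        using that B(2) by blast
      let ?w = "join wA wB" and ?J = "insert j JA"
      have "?w \<in> words V z ?I" by (rule join_words[OF wA wB])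
      moreover have "?J \<subseteq> ?I" using JA JB j by auto
      moreover have "card ?J = Suc M"
        using JA JB j A(1) B(2) finite_subset[OF JA(1) A(1)] by (subst card_insert_disjoint) auto
      moreover have "\<exists>T \<subseteq> ?I. flexible t c u i e T"
        if u: "u \<in> words V z ?I" "\<forall>i. i \<notin> ?J \<longrightarrow> u i = ?w i" and i: "i \<in> ?J" and e: "e \<in> E" for u i e
      proof -
        obtain a b where ab: "e = (a, b)" "a \<in> V" "b \<in> V"
          using e E by auto
        define uA where "uA = (\<lambda>i. if i \<in> A then u i else z)"
        define uB where "uB = (\<lambda>i. if i \<in> B then u i else z)"
        have uA: "uA \<in> words V z A" and uB: "uB \<in> words V z B"
          using u(1) by (auto simp: uA_def uB_def words_def)
        have uA_off: "uA i = wA i" if "i \<notin> JA" for i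
          using that u(2)[rule_format, of i] wA jA by (cases "i \<in> A") (auto simp: uA_def join_def words_def)
        have uB_off: "uB i = wB i" if "i \<noteq> j" for i
          using that u(2)[rule_format, of i] wB JA(1) BA[of i] by (cases "i \<in> B") (auto simp: uB_def join_def words_def)
        have uB_upd: "uB = wB(j := u j)"
          using uB_off j JB(1) by (auto simp: uB_def fun_eq_iff)
        have uj: "u j \<in> V"
          using u(1) j JB(1) by (auto simp: words_def)
        show ?thesis
        proof (cases "i = j")
          case True
          obtain T where T: "T \<subseteq> B" "flexible t hB uB j (a, b) T"
            using flexB[OF uB _ _ e] uB_off j ab(1) by auto
          have pl: "place a b T S u = join uA (place a b T S uB)" for S
            using T(1) B(2) u(1) by (auto simp: place_def join_def uA_def uB_def words_def fun_eq_iff)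
          have "flexible t c u j (a, b) T"
          proof (rule flexible_transfer[OF T(2)])
            show "u i = uB i" if "i \<in> T" for i
              using that T(1) by (auto simp: uB_def)
            show "c (place a b T S u) = c (place a b T S' u)"
              if "hB (place a b T S uB) = hB (place a b T S' uB)" for S S'
              unfolding pl
              using hB_eq place_in_words[OF uB T(1) ab(2,3)] that uA by blast
          qed
          then show ?thesis using True T(1) ab(1) by blast
        next
          case False
          then have "i \<in> JA" using i by simp
          then obtain T where T: "T \<subseteq> A" "flexible t hA uA i (a, b) T"
            using flexA[OF uA uA_off _ e] ab(1) by auto
          have pl: "place a b T S u = join (place a b T S uA) (wB(j := u j))" for S
            unfolding uB_upd[symmetric]
            using T(1) B(2) u(1) by (auto simp: place_def join_def uA_def uB_def words_def fun_eq_iff)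
          have "flexible t c u i (a, b) T"
          proof (rule flexible_transfer[OF T(2)])
            show "u i = uA i" if "i \<in> T" for i
              using that T(1) by (auto simp: uA_def)
            show "c (place a b T S u) = c (place a b T S' u)"
              if "hA (place a b T S uA) = hA (place a b T S' uA)" for S S'
              unfolding pl
              using hA_eq place_in_words[OF uA T(1) ab(2,3)] that uj by blast
          qed
          then show ?thesis using T(1) ab(1) by blast
        qed
      qed
      ultimately show "\<exists>w \<in> words V z ?I. \<exists>J \<subseteq> ?I. card J = Suc M \<and>
          (\<forall>u \<in> words V z ?I. (\<forall>i. i \<notin> J \<longrightarrow> u i = w i) \<longrightarrow>
             (\<forall>j \<in> J. \<forall>e \<in> E. \<exists>T \<subseteq> ?I. flexible t c u j e T))"
        by (intro bexI[of _ ?w] exI[of _ ?J]) simp_all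
    qed
    moreover have "finite ?I" "?I \<inter> F = {}"
      using A B by auto
    ultimately show "\<exists>I. finite I \<and> I \<inter> F = {} \<and> forces V z t E (Suc M) r I"
      by blast
  qed
qed

text \<open>
  Inside a large set \<open>J\<close> of positions that are flexible for \<open>E\<close> under all changes on \<open>J\<close>, restrict to
  the letters \<open>a\<close> and \<open>b\<close>. Ramsey's theorem for singletons and then for pairs gives \<open>T \<subseteq> J\<close> on which
  the colour depends only on the number of letters \<open>b\<close>, if this is 1 or 2. Any \<open>j\<close> in \<open>T\<close> is flexible for
  \<open>(a, b)\<close>, and it remains flexible for \<open>E\<close> because only letters on \<open>J\<close> have been changed.
\<close>

lemma unavoidable_insert:
  assumes ab: "a \<in> V" "b \<in> V" and "t \<ge> 2" and many: "\<And>M. unavoidable V z t E M"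
  shows "unavoidable V z t (insert (a, b) E) 1"
  unfolding unavoidable_def
proof (intro allI impI)
  fix r :: nat and F :: "nat set" assume F: "finite F"
  \<comment> \<open>Pairs are made homogeneous after singletons, so their Ramsey number is fixed first.\<close>
  obtain M2 :: nat where M2: "partn_lst {..<M2} (replicate r t) 2"
    using ramsey_full by blast
  obtain M1 :: nat where M1: "partn_lst {..<M1} (replicate r M2) 1"
    using ramsey_full by blast
  obtain I where I: "finite I" "I \<inter> F = {}" and forceI: "forces V z t E M1 r I"
    using unavoidableE[OF many F] .
  have "forces V z t (insert (a, b) E) 1 r I"
    unfolding forces_def
  proof (intro allI impI)
    fix c assume "\<forall>x \<in> words V z I. c x < r"
    then have c: "c x < r" if "x \<in> words V z I" for x
      using that by blast
    obtain w J where w: "w \<in> words V z I" and J: "J \<subseteq> I" "card J = M1"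
      and flex: "\<And>u j e. u \<in> words V z I \<Longrightarrow> (\<And>i. i \<notin> J \<Longrightarrow> u i = w i) \<Longrightarrow>
        j \<in> J \<Longrightarrow> e \<in> E \<Longrightarrow> \<exists>T \<subseteq> I. flexible t c u j e T"
      by (rule forcesE[OF forceI, of c]) (use c in blast)+
    have finJ: "finite J" using J I finite_subset by blast
    have f: "c (place a b J S w) < r" for S
      by (rule c[OF place_in_words[OF w J(1) ab]])
    obtain T1 i1 where T1: "T1 \<in> nsets J M2" "\<And>S. S \<in> nsets T1 1 \<Longrightarrow> c (place a b J S w) = i1"
      using homogeneous_subset[OF M1 finJ J(2), of "\<lambda>S. c (place a b J S w)"] f by blast
    then have "finite T1" "card T1 = M2" by (auto simp: nsets_def)
    then obtain T i2 where T: "T \<in> nsets T1 t" "\<And>S. S \<in> nsets T 2 \<Longrightarrow> c (place a b J S w) = i2"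
      using homogeneous_subset[OF M2, of T1 "\<lambda>S. c (place a b J S w)"] f by blast
    have TJ: "T \<subseteq> J" "T \<subseteq> T1" "card T = t" "finite T"
      using T(1) T1(1) by (auto simp: nsets_def)
    have mono: "c (place a b J S w) = c (place a b J S' w)"
      if "g \<in> {1, 2}" "S \<in> nsets T g" "S' \<in> nsets T g" for g S S'
      using that T1(2)[OF subsetD[OF nsets_mono[OF TJ(2)]]] T(2) by auto
    obtain j where j: "j \<in> T" using TJ(3) \<open>t \<ge> 2\<close> by (cases "T = {}") auto
    have "card (T - {j}) > 0" using j TJ \<open>t \<ge> 2\<close> by simp
    then obtain k where k: "k \<in> T" "k \<noteq> j" by (metis Diff_iff card_gt_0_iff ex_in_conv insertI1)
    let ?w = "place a b J {k} w"
    have "?w \<in> words V z I" by (rule place_in_words[OF w J(1) ab])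
    moreover have "{j} \<subseteq> I" using j TJ(1) J(1) by blast
    moreover have "\<exists>T \<subseteq> I. flexible t c u j e T"
      if u: "u \<in> words V z I" "\<forall>i. i \<notin> {j} \<longrightarrow> u i = ?w i" and e: "e \<in> insert (a, b) E" for u e
    proof (cases "e = (a, b)")
      case True
      have pl: "place a b T S u = place a b J S w" if "S \<subseteq> T" for S
        using u(2) that j k TJ(1) by (auto simp: place_def fun_eq_iff)
      have "flexible t c u j (a, b) T"
        unfolding flexible_def prod.case
      proof (intro conjI bexI[of _ k] ballI)
        fix g :: nat and S S' assume *: "g \<in> {1, 2}" "S \<in> nsets T g" "S' \<in> nsets T g"
        then have "S \<subseteq> T" "S' \<subseteq> T" by (auto simp: nsets_def)
        then show "c (place a b T S u) = c (place a b T S' u)"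
          using mono[OF *] pl by simp
      qed (use u(2) j k TJ in \<open>auto simp: place_def\<close>)
      then show ?thesis using True TJ(1) J(1) by blast
    next
      case False
      have "u i = w i" if "i \<notin> J" for i
        using u(2) that j TJ(1) by (auto simp: place_def)
      then show ?thesis
        using flex[OF u(1)] j TJ(1) e False by blast
    qed
    ultimately show "\<exists>w \<in> words V z I. \<exists>J \<subseteq> I. card J = 1 \<and>
        (\<forall>u \<in> words V z I. (\<forall>i. i \<notin> J \<longrightarrow> u i = w i) \<longrightarrow>
           (\<forall>j \<in> J. \<forall>e \<in> insert (a, b) E. \<exists>T \<subseteq> I. flexible t c u j e T))"
      by (intro bexI[of _ ?w] exI[of _ "{j}"]) simp_all
  qed
  then show "\<exists>I. finite I \<and> I \<inter> F = {} \<and> forces V z t (insert (a, b) E) 1 r I"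
    using I by blast
qed

lemma unavoidable_edges:
  assumes "finite V" "z \<in> V" "t \<ge> 2" "finite E" "E \<subseteq> V \<times> V"
  shows "unavoidable V z t E 1"
  using assms(4,5)
proof (induction E rule: finite_induct)
  case empty
  show ?case by (rule unavoidable_empty[OF assms(2)])
next
  case (insert e E)
  have many: "unavoidable V z t E M" for M
    by (rule unavoidable_blocks[OF assms(1,2) _ insert.IH]) (use insert.prems in simp_all)
  have "unavoidable V z t (insert (fst e, snd e) E) 1"
    by (rule unavoidable_insert[OF _ _ assms(3) many]) (use insert.prems in auto)
  then show ?case by simp
qed

section \<open>Lengthening a monochromatic cycle\<close>

text \<open>
  The cyclic sequence \<open>{v\<^sub>0}, {v\<^sub>0, v\<^sub>1}, {v\<^sub>1}, {v\<^sub>1, v\<^sub>2}, \<dots>, {v\<^sub>q\<^sub>-\<^sub>1}, {v\<^sub>q\<^sub>-\<^sub>1, v\<^sub>0}\<close> of length \<open>2q\<close>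
  with \<open>v\<^sub>0 = k\<close> and \<open>v\<^sub>q\<^sub>-\<^sub>1 = j\<close>. For \<open>q = 2\<close> the two pairs would coincide.
\<close>

lemma alternating_detour:
  assumes T: "finite T" "j \<in> T" "k \<in> T" "j \<noteq> k" and q: "3 \<le> q" "q \<le> card T"
  obtains D :: "nat \<Rightarrow> 'b set" where "D 0 = {k}" and "D (2 * q - 1) = {j, k}"
    and "\<And>n. n < 2 * q \<Longrightarrow> D n \<in> nsets T 1 \<union> nsets T 2" and "inj_on D {..<2 * q}"
    and "\<And>n. Suc n < 2 * q \<Longrightarrow> \<exists>x \<in> T. (x \<notin> D n \<and> D (Suc n) = insert x (D n)) \<or>
      (x \<notin> D (Suc n) \<and> D n = insert x (D (Suc n)))"
proof -
  obtain xs where xs: "set xs = T - {j, k}" "distinct xs"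
    using finite_distinct_list[of "T - {j, k}"] T(1) by auto
  have "length xs = card T - 2"
    using distinct_card[OF xs(2)] xs(1) T by (simp add: card_Diff_subset)
  \<comment> \<open>The enumeration of q elements of T that starts with k and ends with j.\<close>
  define L where "L = k # take (q - 2) xs @ [j]"
  have len: "length L = q"
    using \<open>length xs = card T - 2\<close> q by (simp add: L_def)
  have "set (take (q - 2) xs) \<subseteq> T - {j, k}"
    using set_take_subset[of "q - 2" xs] xs(1) by simp
  then have dist: "distinct L" and LT: "set L \<subseteq> T"
    using xs(2) T unfolding L_def by auto
  define v where "v = (\<lambda>i. L ! i)"
  have v_eq: "v i = v i' \<longleftrightarrow> i = i'" if "i < q" "i' < q" for i i'
    using that dist len by (simp add: v_def nth_eq_iff_index_eq)
  have vT: "v i \<in> T" if "i < q" for i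
    using that LT len nth_mem[of i L] by (auto simp: v_def)
  have v0: "v 0 = k"
    by (simp add: v_def L_def)
  have "length (k # take (q - 2) xs) = q - 1"
    using \<open>length xs = card T - 2\<close> q by simp
  then have v_last: "v (q - 1) = j"
    unfolding v_def L_def by (metis append_Cons nth_append_length)
  define nx where "nx i = Suc i mod q" for i
  have nx: "nx i < q" for i
    using q by (simp add: nx_def)
  have nx_eq: "nx i = (if Suc i = q then 0 else Suc i)" if "i < q" for i
    using that by (simp add: nx_def)
  define D where "D n = (if even n then {v (n div 2)} else {v (n div 2), v (nx (n div 2))})" for n
  have Deven: "D (2 * i) = {v i}" and Dodd: "D (Suc (2 * i)) = {v i, v (nx i)}" for i
    by (simp_all add: D_def)
  have nx_neq: "v (nx i) \<noteq> v i" if "i < q" for i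
  proof -
    have "nx i \<noteq> i"
      using nx_eq[OF that] q(1) by (simp split: if_splits)
    then show ?thesis
      using v_eq[OF nx that] by simp
  qed
  have cardD: "card (D n) = (if even n then 1 else 2)" if "n < 2 * q" for n
  proof -
    have "n div 2 < q" using that by simp
    then show ?thesis
      using nx_neq[of "n div 2"] by (simp add: D_def card_insert_if)
  qed
  show thesis
  proof
    show "D 0 = {k}"
      using Deven[of 0] v0 by simp
    have "2 * q - 1 = Suc (2 * (q - 1))"
      using q by simp
    then show "D (2 * q - 1) = {j, k}"
      using Dodd[of "q - 1"] v0 v_last nx_eq[of "q - 1"] q by simp
    show "D n \<in> nsets T 1 \<union> nsets T 2" if "n < 2 * q" for n
    proof -
      have "n div 2 < q" using that by simp
      then have "D n \<subseteq> T" "finite (D n)"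
        using vT nx by (auto simp: D_def)
      then show ?thesis
        using cardD[OF that] by (simp add: nsets_def)
    qed
    show "inj_on D {..<2 * q}"
    proof (rule inj_onI)
      fix n n' assume n: "n \<in> {..<2 * q}" "n' \<in> {..<2 * q}" and eq: "D n = D n'"
      have par: "even n \<longleftrightarrow> even n'"
      proof -
        have "card (D n) = (if even n then 1 else 2)" "card (D n') = (if even n' then 1 else 2)"
          using cardD n by blast+
        then have "(if even n then 1 else 2 :: nat) = (if even n' then 1 else 2)"
          using eq by metis
        then show ?thesis by (simp split: if_splits)
      qed
      have lt: "n div 2 < q" "n' div 2 < q"
        using n by auto
      have "n div 2 = n' div 2"
      proof (cases "even n")
        case True
        then show ?thesis
          using eq par v_eq[OF lt] by (simp add: D_def)
      next
        case False
        then have "odd n'" using par by simp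
        have "D n = {v (n div 2), v (nx (n div 2))}"
          unfolding D_def using False by (rule if_not_P)
        moreover have "D n' = {v (n' div 2), v (nx (n' div 2))}"
          unfolding D_def using \<open>odd n'\<close> by (rule if_not_P)
        ultimately have "{v (n div 2), v (nx (n div 2))} = {v (n' div 2), v (nx (n' div 2))}"
          using eq by (simp only:)
        then have "n div 2 = n' div 2 \<or> (n div 2 = nx (n' div 2) \<and> nx (n div 2) = n' div 2)"
          unfolding doubleton_eq_iff
          using v_eq[OF lt] v_eq[OF lt(1) nx] v_eq[OF nx lt(2)] by blast
        then show ?thesis
          using nx_eq[OF lt(1)] nx_eq[OF lt(2)] q lt by (auto split: if_splits)
      qed
      then show "n = n'"
        using par by (metis even_two_times_div_two odd_two_times_div_two_succ)
    qed
    show "\<exists>x \<in> T. (x \<notin> D n \<and> D (Suc n) = insert x (D n)) \<or>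
        (x \<notin> D (Suc n) \<and> D n = insert x (D (Suc n)))" if "Suc n < 2 * q" for n
    proof (cases "even n")
      case True
      then obtain i where i: "n = 2 * i" by (rule evenE)
      then have iq: "i < q" using that by simp
      show ?thesis
        unfolding i Deven Dodd using nx_neq[OF iq] vT[OF nx] by auto
    next
      case False
      then obtain i where i: "n = 2 * i + 1" by (rule oddE)
      then have iq: "i < q" "Suc i < q" using that by simp_all
      have "D (Suc n) = {v (Suc i)}" "D n = {v i, v (Suc i)}"
        using Deven[of "Suc i"] Dodd[of i] i nx_eq[OF iq(1)] iq by simp_all
      moreover have "v i \<noteq> v (Suc i)"
        using v_eq[OF iq] by simp
      ultimately show ?thesis
        using vT[OF iq(1)] by auto
    qed
  qed
qed

text \<open>
  Placing \<open>b\<close> on the sets of the alternating sequence turns it into a path of words. All its words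
  have the colour of one of the two ends. A word strictly between the ends does not lie in the fibre
  over \<open>j\<close>: its set would agree with \<open>{k}\<close> off \<open>j\<close>, so it would be \<open>{k}\<close> or \<open>{j, k}\<close>.
\<close>

lemma flexible_detour:
  assumes flex: "flexible t c w j (a, b) T" and "a \<noteq> b" and q: "3 \<le> q" "q \<le> t"
    and col: "c (w(j := a)) = col" "c (w(j := b)) = col"
  shows "\<exists>P. P 0 = w(j := a) \<and> P (2 * q - 1) = w(j := b) \<and> inj_on P {..<2 * q} \<and>
    (\<forall>n < 2 * q. c (P n) = col \<and> (\<exists>S. P n = place a b T S w)) \<and>
    (\<forall>n. Suc n < 2 * q \<longrightarrow> (\<exists>x \<in> T. {P n x, P (Suc n) x} = {a, b} \<and>
      (\<forall>i. i \<noteq> x \<longrightarrow> P n i = P (Suc n) i))) \<and>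
    (\<forall>n v. 0 < n \<and> n < 2 * q - 1 \<longrightarrow> P n \<noteq> w(j := v))"
proof -
  from flex obtain k where k: "k \<in> T" "k \<noteq> j" "w k = b" "\<And>i. i \<in> T - {j, k} \<Longrightarrow> w i = a"
    and cardT: "card T = t" and jT: "j \<in> T"
    and same: "\<And>g S S'. g \<in> {1, 2} \<Longrightarrow> S \<in> nsets T g \<Longrightarrow> S' \<in> nsets T g \<Longrightarrow>
         c (place a b T S w) = c (place a b T S' w)"
    unfolding flexible_def prod.case by blast
  have finT: "finite T"
    using cardT q by (metis card.infinite not_numeral_le_zero order_trans)
  obtain D where D0: "D 0 = {k}" and Dlast: "D (2 * q - 1) = {j, k}"
    and DT: "\<And>n. n < 2 * q \<Longrightarrow> D n \<in> nsets T 1 \<union> nsets T 2" and injD: "inj_on D {..<2 * q}"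
    and Dstep: "\<And>n. Suc n < 2 * q \<Longrightarrow> \<exists>x \<in> T. (x \<notin> D n \<and> D (Suc n) = insert x (D n)) \<or>
      (x \<notin> D (Suc n) \<and> D n = insert x (D (Suc n)))"
    by (rule alternating_detour[OF finT jT k(1) k(2)[symmetric] q(1)]) (use q cardT in auto)
  have Dsub: "D n \<subseteq> T" if "n < 2 * q" for n
    using DT[OF that] by (auto simp: nsets_def)
  let ?P = "\<lambda>n. place a b T (D n) w"
  have pk: "place a b T {k} w = w(j := a)"
    using k jT by (auto simp: place_def fun_eq_iff)
  have pjk: "place a b T {j, k} w = w(j := b)"
    using k jT by (auto simp: place_def fun_eq_iff)
  have place_inj: "S = S'" if "S \<subseteq> T" "S' \<subseteq> T" "place a b T S w = place a b T S' w" for S S'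
  proof -
    have "i \<in> S \<longleftrightarrow> i \<in> S'" if "i \<in> T" for i
      using fun_cong[OF \<open>place a b T S w = place a b T S' w\<close>, of i] that \<open>a \<noteq> b\<close>
      by (simp add: place_def split: if_splits)
    then show ?thesis using that(1,2) by blast
  qed
  show ?thesis
  proof (intro exI[of _ ?P] conjI allI impI)
    show "?P 0 = w(j := a)" using D0 pk by simp
    show "?P (2 * q - 1) = w(j := b)" using Dlast pjk by simp
    show "inj_on ?P {..<2 * q}"
    proof (rule inj_onI)
      fix n n' assume n: "n \<in> {..<2 * q}" "n' \<in> {..<2 * q}" "?P n = ?P n'"
      then have "D n = D n'" using place_inj Dsub by simp
      then show "n = n'" using inj_onD[OF injD _ n(1,2)] by simp
    qed
    fix n assume n: "n < 2 * q"
    show "c (?P n) = col"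
    proof -
      have "{k} \<in> nsets T 1" "{j, k} \<in> nsets T 2"
        using k jT by (auto simp: nsets_def)
      then show ?thesis
        using DT[OF n] same[of 1 "D n" "{k}"] same[of 2 "D n" "{j, k}"] col pk pjk by auto
    qed
    show "\<exists>S. ?P n = place a b T S w" by blast
  next
    fix n assume n: "Suc n < 2 * q"
    show "\<exists>x \<in> T. {?P n x, ?P (Suc n) x} = {a, b} \<and> (\<forall>i. i \<noteq> x \<longrightarrow> ?P n i = ?P (Suc n) i)"
    proof -
      obtain x where x: "x \<in> T" "(x \<notin> D n \<and> D (Suc n) = insert x (D n)) \<or>
          (x \<notin> D (Suc n) \<and> D n = insert x (D (Suc n)))"
        using Dstep[OF n] by blast
      then show ?thesis
        by (intro bexI[of _ x]) (auto simp: place_def)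
    qed
  next
    fix n v assume "0 < n \<and> n < 2 * q - 1"
    then have n: "0 < n" "n < 2 * q - 1" by simp_all
    show "?P n \<noteq> w(j := v)"
    proof
      assume eq: "?P n = w(j := v)"
      have "i \<in> D n \<longleftrightarrow> i = k" if "i \<in> T" "i \<noteq> j" for i
        using fun_cong[OF eq, of i] that k(3) k(4)[of i] \<open>a \<noteq> b\<close>
        by (auto simp: place_def split: if_splits)
      moreover have "D n \<subseteq> T"
        using Dsub n by simp
      ultimately have "D n = {k} \<or> D n = {j, k}"
        using k(1,2) by (cases "j \<in> D n") blast+
      then have "D n = D 0 \<or> D n = D (2 * q - 1)"
        using D0 Dlast by simp
      moreover have "n \<in> {..<2 * q}" "0 \<in> {..<2 * q}" "2 * q - 1 \<in> {..<2 * q}"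
        using n by simp_all
      ultimately have "n = 0 \<or> n = 2 * q - 1"
        using inj_onD[OF injD] by blast
      then show False using n by simp
    qed
  qed
qed

text \<open>
  The cycle in the fibre over \<open>j\<close> is followed from \<open>y 0\<close> to \<open>y (2 * i)\<close>, and its last edge back to
  \<open>y 0\<close> is replaced by a detour with \<open>2 * (s - i + 1) - 1\<close> edges, for a total of
  \<open>2 * i + 2 * (s - i) + 1 = 2 * s + 1\<close>. A detour through \<open>s - i + 1\<close> positions exists because this number
  is at least 3, by \<open>i + 2 \<le> s\<close>, and at most \<open>s\<close>, by \<open>1 \<le> i\<close>.
\<close>

lemma reroute_cycle:
  assumes y: "is_cycle (parcs G) (2 * i + 1) y" and i: "1 \<le> i" "i + 2 \<le> s"
    and G: "pair_graph G" and z: "z \<in> pverts G"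
    and w: "w \<in> words (pverts G) z I" and I: "I \<subseteq> {..<n}" "j \<in> I"
    and T: "T \<subseteq> I" and flex: "flexible s (\<lambda>x. c (map x [0..<n])) w j (y (2 * i), y 0) T"
    and col: "\<And>k. k < 2 * i + 1 \<Longrightarrow> c (map (w(j := y k)) [0..<n]) = col"
  shows "\<exists>x. is_cycle (parcs (cart_power G n)) (2 * s + 1) x \<and> (\<forall>k < 2 * s + 1. c (x k) = col)"
proof -
  let ?V = "pverts G" and ?a = "y (2 * i)" and ?b = "y 0" and ?q = "s - i + 1"
  have injy: "inj_on y {..<2 * i + 1}"
    and edge: "\<And>k. k < 2 * i + 1 \<Longrightarrow> (y k, y (Suc k mod (2 * i + 1))) \<in> parcs G"
    using y unfolding is_cycle_def by blast+
  have yV: "y k \<in> ?V" if "k < 2 * i + 1" for k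
    using pair_graphD(2)[OF G edge[OF that]] by blast
  have ab: "(?a, ?b) \<in> parcs G" "(?b, ?a) \<in> parcs G" "?a \<noteq> ?b" "?a \<in> ?V" "?b \<in> ?V"
    using edge[of "2 * i"] pair_graphD(2)[OF G, of ?a ?b] by auto
  have q: "3 \<le> ?q" "?q \<le> s" "2 * ?q - 1 = 2 * s - 2 * i + 1"
    using i by auto
  have col_ab: "c (map (w(j := ?a)) [0..<n]) = col" "c (map (w(j := ?b)) [0..<n]) = col"
    using col[of "2 * i"] col[of 0] by simp_all
  have "\<exists>P. P 0 = w(j := ?a) \<and> P (2 * ?q - 1) = w(j := ?b) \<and> inj_on P {..<2 * ?q} \<and>
    (\<forall>n' < 2 * ?q. c (map (P n') [0..<n]) = col \<and> (\<exists>S. P n' = place ?a ?b T S w)) \<and>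
    (\<forall>n'. Suc n' < 2 * ?q \<longrightarrow> (\<exists>x \<in> T. {P n' x, P (Suc n') x} = {?a, ?b} \<and>
      (\<forall>i. i \<noteq> x \<longrightarrow> P n' i = P (Suc n') i))) \<and>
    (\<forall>n' v. 0 < n' \<and> n' < 2 * ?q - 1 \<longrightarrow> P n' \<noteq> w(j := v))"
    by (rule flexible_detour[OF flex ab(3) q(1,2) col_ab])
  then obtain P where P0: "P 0 = w(j := ?a)" and Plast: "P (2 * ?q - 1) = w(j := ?b)"
    and injP: "inj_on P {..<2 * ?q}"
    and P: "\<forall>n' < 2 * ?q. c (map (P n') [0..<n]) = col \<and> (\<exists>S. P n' = place ?a ?b T S w)"
    and Pstep: "\<forall>n'. Suc n' < 2 * ?q \<longrightarrow> (\<exists>x \<in> T. {P n' x, P (Suc n') x} = {?a, ?b} \<and>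
      (\<forall>i. i \<noteq> x \<longrightarrow> P n' i = P (Suc n') i))"
    and Poff: "\<forall>n' v. 0 < n' \<and> n' < 2 * ?q - 1 \<longrightarrow> P n' \<noteq> w(j := v)"
    by (elim exE conjE)
  \<comment> \<open>The two branches fit together at both ends: Z (2 * i) = P 0, and P (2 * ?q - 1) = Z 0.\<close>
  define Z where "Z k = (if k \<le> 2 * i then w(j := y k) else P (k - 2 * i))" for k
  have Pwords: "P k \<in> words ?V z I" if "k < 2 * ?q" for k
  proof -
    obtain S where "P k = place ?a ?b T S w"
      using P \<open>k < 2 * ?q\<close> by blast
    then show ?thesis
      using place_in_words[OF w T ab(4,5)] by simp
  qed
  have wj: "w(j := v) \<in> words ?V z I" if "v \<in> ?V" for v
    using w I(2) that by (auto simp: words_def)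
  have Zwords: "Z k \<in> words ?V z I" if "k < 2 * s + 1" for k
    using wj[OF yV[of k]] Pwords[of "k - 2 * i"] that i by (simp add: Z_def)
  have Zcol: "c (map (Z k) [0..<n]) = col" if "k < 2 * s + 1" for k
    using col[of k] P[rule_format, of "k - 2 * i"] that i by (simp add: Z_def)
  have Zdiff: "Z k \<noteq> Z k'" if k: "k < k'" "k' < 2 * s + 1" for k k'
  proof -
    consider "k' \<le> 2 * i" | "k \<le> 2 * i" "2 * i < k'" | "2 * i < k" by linarith
    then show ?thesis
    proof cases
      case 1
      then have "y k \<noteq> y k'"
        using inj_onD[OF injy, of k k'] k by auto
      then show ?thesis
        using 1 k by (auto simp: Z_def dest: fun_cong[of _ _ j])
    next
      case 2
      then have "0 < k' - 2 * i" "k' - 2 * i < 2 * ?q - 1"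
        unfolding q(3) using k i by arith+
      then have "P (k' - 2 * i) \<noteq> w(j := y k)"
        using Poff by blast
      then show ?thesis
        using 2 by (simp add: Z_def)
    next
      case 3
      then have "k - 2 * i < 2 * ?q" "k' - 2 * i < 2 * ?q" "k - 2 * i \<noteq> k' - 2 * i"
        using k i by arith+
      then have "P (k - 2 * i) \<noteq> P (k' - 2 * i)"
        using inj_on_eq_iff[OF injP] by simp
      then show ?thesis
        using 3 k by (simp add: Z_def)
    qed
  qed
  have Zstep: "\<exists>x \<in> I. (Z k x, Z (Suc k mod (2 * s + 1)) x) \<in> parcs G \<and>
      (\<forall>i. i \<noteq> x \<longrightarrow> Z k i = Z (Suc k mod (2 * s + 1)) i)" if k: "k < 2 * s + 1" for k
  proof (cases "k < 2 * i")
    case True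
    then have "Z k = w(j := y k)" "Z (Suc k mod (2 * s + 1)) = w(j := y (Suc k))"
      using i by (simp_all add: Z_def)
    then show ?thesis
      using edge[of k] True I(2) by (intro bexI[of _ j]) simp_all
  next
    case False
    let ?k = "k - 2 * i"
    have Zk: "Z k = P ?k"
      using False P0 by (cases "k = 2 * i") (simp_all add: Z_def)
    have Zsuc: "Z (Suc k mod (2 * s + 1)) = P (Suc ?k)"
    proof (cases "k = 2 * s")
      case True
      then have "Suc ?k = 2 * ?q - 1" using i by simp
      then show ?thesis using True Plast by (simp add: Z_def)
    next
      case False
      then show ?thesis using k \<open>\<not> k < 2 * i\<close> by (simp add: Z_def Suc_diff_le)
    qed
    have "Suc ?k < 2 * ?q"
      using k i by simp
    then obtain x where x: "x \<in> T" "{P ?k x, P (Suc ?k) x} = {?a, ?b}"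
      "\<forall>i. i \<noteq> x \<longrightarrow> P ?k i = P (Suc ?k) i"
      using Pstep by blast
    have "(P ?k x, P (Suc ?k) x) \<in> parcs G"
      using x(2) ab(1,2) by (auto simp: doubleton_eq_iff)
    then show ?thesis
      unfolding Zk Zsuc using x T by blast
  qed
  let ?x = "\<lambda>k. map (Z k) [0..<n]"
  have "inj_on ?x {..<2 * s + 1}"
  proof (rule inj_onI)
    fix k k' assume k: "k \<in> {..<2 * s + 1}" "k' \<in> {..<2 * s + 1}" and eq: "?x k = ?x k'"
    have "Z k i = Z k' i" for i
    proof (cases "i \<in> I")
      case True
      then have "i < n" using I by auto
      then show ?thesis using arg_cong[OF eq, of "\<lambda>l. l ! i"] by simp
    next
      case False
      then show ?thesis using Zwords[of k] Zwords[of k'] k by (simp add: words_def)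
    qed
    then have "Z k = Z k'" by (rule ext)
    then show "k = k'"
      using Zdiff[of k k'] Zdiff[of k' k] k by (cases k k' rule: linorder_cases) auto
  qed
  moreover have "(?x k, ?x (Suc k mod (2 * s + 1))) \<in> parcs (cart_power G n)" if k: "k < 2 * s + 1" for k
  proof -
    obtain x where x: "x \<in> I" "(Z k x, Z (Suc k mod (2 * s + 1)) x) \<in> parcs G"
      "\<forall>i. i \<noteq> x \<longrightarrow> Z k i = Z (Suc k mod (2 * s + 1)) i"
      using Zstep[OF k] by blast
    show ?thesis
    proof (rule parcs_cart_power[where j = x and w = "Z k" and w' = "Z (Suc k mod (2 * s + 1))"])
      show "pair_graph G" by (rule G)
      show "x < n" using x(1) I(1) by auto
      show "(Z k x, Z (Suc k mod (2 * s + 1)) x) \<in> parcs G" by (rule x(2))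
      show "Z k i = Z (Suc k mod (2 * s + 1)) i" if "i \<noteq> x" for i
        using x(3) that by blast
      show "Z k i \<in> pverts G" if "i < n" for i
        using Zwords[OF k] z by (cases "i \<in> I") (simp_all add: words_def)
    qed
  qed
  ultimately show ?thesis
    using Zcol unfolding is_cycle_def by blast
qed


section \<open>Vertex colourings of Cartesian powers\<close>

text \<open>
  By \<open>unavoidable_edges\<close>, some position is flexible for all edges of \<open>G\<close> with sets \<open>T\<close> of size \<open>s\<close>,
  which is enough for every length of the initial cycle. The monochromatic odd cycle in the fibre
  over that position is then lengthened.
\<close>

lemma arrows_power_longer_odd_cycle:
  fixes G :: "'a pair_pre_digraph"
  assumes G: "pair_graph G" and r: "r \<ge> 1"
    and arr: "arrows r G {cycle_graph (2 * i + 1) | i. i \<in> {1..l}}" and s: "l + 2 \<le> s"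
  shows "\<exists>n \<ge> 1. arrows r (cart_power G n) {cycle_graph (2 * s + 1)}"
proof -
  let ?V = "pverts G"
  let ?L = "(\<lambda>i. 2 * i + 1) ` {1..l}"
  have L: "m \<ge> 3" if "m \<in> ?L" for m
    using that by auto
  have "{cycle_graph (2 * i + 1) | i. i \<in> {1..l}} = cycle_graph ` ?L"
    by auto
  then have "arrows r G (cycle_graph ` ?L)"
    using arr by simp
  then have "\<forall>c. c ` ?V \<subseteq> {..<r} \<longrightarrow> (\<exists>m \<in> ?L. \<exists>y.
      is_cycle (parcs G) m y \<and> (\<forall>k<m. c (y k) = c (y 0)))"
    by (rule iffD1[OF arrows_cycles_iff[OF G], rotated]) (rule L)
  then have odd_cycle: "\<exists>i \<in> {1..l}. \<exists>y. is_cycle (parcs G) (2 * i + 1) y \<and>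
      (\<forall>k < 2 * i + 1. c (y k) = c (y 0))" if "c ` ?V \<subseteq> {..<r}" for c
    using that unfolding bex_simps(7) by blast
  have edge0: "(y (2 * i), y 0) \<in> parcs G" if "is_cycle (parcs G) (2 * i + 1) y" for i y
    using is_cycle_edge[OF that, of "2 * i"] by simp
  \<comment> \<open>The constant colouring yields a cycle in G, hence a vertex to serve as default letter.\<close>
  have "(\<lambda>_. 0) ` ?V \<subseteq> {..<r}"
    using r by auto
  then obtain i y where "is_cycle (parcs G) (2 * i + 1) y"
    using odd_cycle by blast
  then obtain z where z: "z \<in> ?V"
    using pair_graphD(2)[OF G edge0] by blast
  have sub: "parcs G \<subseteq> ?V \<times> ?V"
    using pair_graphD(2)[OF G] by auto
  have fin: "finite ?V" "finite (parcs G)"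
    using pair_graphD(1)[OF G] finite_subset[OF sub] by simp_all
  have "s \<ge> 2" using s by simp
  obtain I where I: "finite I" "I \<inter> {} = {}" and forceI: "forces ?V z s (parcs G) 1 r I"
    using unavoidableE[OF unavoidable_edges[OF fin(1) z \<open>s \<ge> 2\<close> fin(2) sub] finite.emptyI] .
  obtain n0 where "I \<subseteq> {..<n0}"
    using I(1) finite_nat_iff_bounded by blast
  then obtain n where n: "I \<subseteq> {..<n}" "n \<ge> 1"
    by (intro that[of "Suc n0"]) auto
  have "\<exists>y. is_cycle (parcs (cart_power G n)) (2 * s + 1) y \<and> (\<forall>k < 2 * s + 1. c (y k) = c (y 0))"
    if c: "c ` pverts (cart_power G n) \<subseteq> {..<r}" for c
  proof -
    let ?c = "\<lambda>x. c (map x [0..<n])"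
    have c_words: "?c x < r" if "x \<in> words ?V z I" for x
    proof -
      have "x i \<in> ?V" for i
        using that z by (cases "i \<in> I") (simp_all add: words_def)
      then have "map x [0..<n] \<in> pverts (cart_power G n)"
        by (auto simp: pverts_cart_power)
      then show ?thesis using c by auto
    qed
    obtain w J where w: "w \<in> words ?V z I" and J: "J \<subseteq> I" "card J = 1"
      and flex: "\<And>u j e. u \<in> words ?V z I \<Longrightarrow> (\<And>i. i \<notin> J \<Longrightarrow> u i = w i) \<Longrightarrow> j \<in> J \<Longrightarrow>
        e \<in> parcs G \<Longrightarrow> \<exists>T \<subseteq> I. flexible s ?c u j e T"
      by (rule forcesE[OF forceI, of ?c]) (use c_words in blast)+
    obtain j where j: "J = {j}"
      using J(2) by (rule card_1_singletonE)
    let ?g = "\<lambda>v. ?c (w(j := v))"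
    have "w(j := v) \<in> words ?V z I" if "v \<in> ?V" for v
      using w that J(1) j by (auto simp: words_def)
    then have "?g ` ?V \<subseteq> {..<r}"
      using c_words by auto
    then obtain i y where i: "i \<in> {1..l}" and y: "is_cycle (parcs G) (2 * i + 1) y"
      and mono: "\<forall>k < 2 * i + 1. ?g (y k) = ?g (y 0)"
      using odd_cycle[of ?g] by blast
    obtain T where T: "T \<subseteq> I" "flexible s ?c w j (y (2 * i), y 0) T"
      using flex[OF w refl _ edge0[OF y], of j] j by blast
    have "\<exists>x. is_cycle (parcs (cart_power G n)) (2 * s + 1) x \<and>
        (\<forall>k < 2 * s + 1. c (x k) = ?g (y 0))"
    proof (rule reroute_cycle[OF y _ _ G z w n(1) _ T])
      show "?g (y k) = ?g (y 0)" if "k < 2 * i + 1" for k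
        using mono that by blast
    qed (use i s J(1) j in auto)
    then show ?thesis by (metis zero_less_Suc Suc_eq_plus1)
  qed
  then have "\<forall>c. c ` pverts (cart_power G n) \<subseteq> {..<r} \<longrightarrow> (\<exists>m \<in> {2 * s + 1}. \<exists>y.
      is_cycle (parcs (cart_power G n)) m y \<and> (\<forall>k<m. c (y k) = c (y 0)))"
    by simp
  then have "arrows r (cart_power G n) (cycle_graph ` {2 * s + 1})"
    by (rule iffD2[OF arrows_cycles_iff[OF pair_graph_cart_power[OF G]], rotated]) (use s in simp)
  then show ?thesis
    using n(2) by (intro exI[of _ n]) simp
qed

text \<open>
  A cycle of length \<open>2 * i + 1\<close> needs that many vertices, so the odd cycle found in a colour class is
  among the lengths up to \<open>2 * l + 1\<close>.
\<close>

lemma arrows_short_odd_cycles: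
  assumes G: "pair_graph G" and chi: "chromatic_number G > 2 * r" and l: "card (pverts G) \<le> 2 * l + 1"
  shows "arrows r G {cycle_graph (2 * i + 1) | i. i \<in> {1..l}}"
proof -
  have "\<exists>m \<in> (\<lambda>i. 2 * i + 1) ` {1..l}. \<exists>y. is_cycle (parcs G) m y \<and> (\<forall>k<m. c (y k) = c (y 0))"
    if c: "c ` pverts G \<subseteq> {..<r}" for c
  proof -
    obtain i y where i: "i \<ge> 1" and y: "is_cycle (parcs G) (2 * i + 1) y"
      and mono: "\<And>k. k < 2 * i + 1 \<Longrightarrow> c (y k) = c (y 0)"
      using monochromatic_odd_cycle[OF G chi c] by metis
    have "y ` {..<2 * i + 1} \<subseteq> pverts G"
      using y pair_graphD(2)[OF G] unfolding is_cycle_def by blast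
    then have "2 * i + 1 \<le> card (pverts G)"
      using y card_inj_on_le[of y "{..<2 * i + 1}" "pverts G"] pair_graphD(1)[OF G]
      unfolding is_cycle_def by simp
    then have "i \<in> {1..l}" using i l by simp
    then show ?thesis using y mono by blast
  qed
  then have "arrows r G (cycle_graph ` ((\<lambda>i. 2 * i + 1) ` {1..l}))"
    by (subst arrows_cycles_iff[OF G]) auto
  moreover have "cycle_graph ` ((\<lambda>i. 2 * i + 1) ` {1..l}) = {cycle_graph (2 * i + 1) | i. i \<in> {1..l}}"
    by auto
  ultimately show ?thesis by simp
qed

theorem theorem2:
  fixes G :: "'a pair_pre_digraph" and m r :: nat
  assumes "pair_graph G" and "card (pverts G) = m" and "r \<ge> 1"
  shows "(\<forall>l::nat. l \<ge> 1 \<longrightarrow> arrows r G {cycle_graph (2 * i + 1) | i. i \<in> {1..l}} \<longrightarrow>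
            (\<forall>s::nat. s \<ge> l + 2 \<longrightarrow>
               (\<exists>n::nat. n \<ge> 1 \<and> arrows r (cart_power G n) {cycle_graph (2 * s + 1)})))
       \<and> (\<forall>s::nat. chromatic_number G > 2 * r \<and> 2 * s + 1 \<ge> m + 4 \<longrightarrow>
            (\<exists>n::nat. n \<ge> 1 \<and> arrows r (cart_power G n) {cycle_graph (2 * s + 1)}))"
proof (intro conjI allI impI)
  fix l s :: nat
  assume "arrows r G {cycle_graph (2 * i + 1) | i. i \<in> {1..l}}" "s \<ge> l + 2"
  then show "\<exists>n \<ge> 1. arrows r (cart_power G n) {cycle_graph (2 * s + 1)}"
    by (rule arrows_power_longer_odd_cycle[OF assms(1,3)])
next
  fix s :: nat
  assume s: "chromatic_number G > 2 * r \<and> 2 * s + 1 \<ge> m + 4"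
  then have "arrows r G {cycle_graph (2 * i + 1) | i. i \<in> {1..s - 2}}"
    using assms(2) by (intro arrows_short_odd_cycles[OF assms(1)]) auto
  moreover have "(s - 2) + 2 \<le> s"
    using conjunct2[OF s] by linarith
  ultimately show "\<exists>n \<ge> 1. arrows r (cart_power G n) {cycle_graph (2 * s + 1)}"
    by (rule arrows_power_longer_odd_cycle[OF assms(1,3)])
qed

end
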